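(* Let $n \geq 1$ and let $A \in \mathbb{R}^{n \times n}$ be a real square matrix. Then there exists a normal matrix $X \in \mathbb{C}^{n \times n}$ such that $\mathrm{Re}(X) = A$.
   Context: For a complex matrix $X$, $X^* = \overline{X}^{\top}$ denotes the conjugate transpose, and $\mathrm{Re}(X)$ denotes the entrywise real part. A complex square matrix $X$ is normal if $XX^* = X^*X$. *)

theory Defs
  imports "HOL.Complex" "Jordan_Normal_Form.Schur_Decomposition"
begin

text \<open>For complex entries, \<^const>\<open>mat_adjoint\<close> is the conjugate transpose.\<close>

definition normal_mat :: "complex mat \<Rightarrow> bool" where
  "normal_mat X \<longleftrightarrow> square_mat X \<and> X * mat_adjoint X = mat_adjoint X * X"

end

theory Submission
  imports Defs
begin

text \<open>Adding a real scalar matrix preserves normality, so \<open>A\<close> may be replaced by an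
invertible \<open>C = A - e I\<close>. Then \<open>C C\<^sup>T = P D P\<^sup>T\<close> with \<open>P\<close> orthogonal and
\<open>D = diag d\<close> positive. Choose \<open>r \<ge> d\<^sub>k\<close> for all \<open>k\<close>, put
\<open>g\<^sub>k = sqrt (r / d\<^sub>k - 1)\<close> and multiply the \<open>k\<close>-th row of \<open>P\<^sup>T C\<close> by \<open>1 + i g\<^sub>k\<close>; this leaves
the real part \<open>P\<^sup>T C\<close>, and the rows become orthogonal of squared length \<open>(1 + g\<^sub>k\<^sup>2) d\<^sub>k = r\<close>.
Multiplying by \<open>P\<close> gives a scalar multiple of a unitary matrix with real part \<open>C\<close>.\<close>

section \<open>Real symmetric matrices\<close>

text \<open>The characteristic polynomial has a complex root \<open>z\<close> by the fundamental
  theorem of algebra. Evaluating the Hermitian form at an eigenvector in two ways shows that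
  \<open>z\<close> is its own conjugate, so it is already a root over the reals.\<close>

lemma real_symmetric_eigenvalue_exists:
  fixes M :: "real mat"
  assumes M: "M \<in> carrier_mat n n" and sym: "transpose_mat M = M" and n: "n \<noteq> 0"
  shows "\<exists>e. eigenvalue M e"
proof -
  let ?h = "complex_of_real"
  let ?M = "map_mat ?h M"
  have M': "?M \<in> carrier_mat n n" using M by auto
  have "degree (char_poly ?M) = n" using degree_monic_char_poly[OF M'] by simp
  hence "\<not> constant (poly (char_poly ?M))" using n by (simp add: constant_degree)
  then obtain z where z: "poly (char_poly ?M) z = 0"
    using fundamental_theorem_of_algebra by blast
  hence "eigenvalue ?M z" using eigenvalue_root_char_poly[OF M'] by simp
  then obtain v where v: "v \<in> carrier_vec n" and v0: "v \<noteq> 0\<^sub>v n"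
    and ev: "?M *\<^sub>v v = z \<cdot>\<^sub>v v"
    using M' unfolding eigenvalue_def eigenvector_def by auto
  have cv: "conjugate v \<in> carrier_vec n" using v by simp
  have symc: "transpose_mat ?M = ?M" using sym by (metis map_mat_transpose)
  \<comment> \<open>The entries of \<open>?M\<close> are real, so conjugation acts on the vector
    alone.\<close>
  have "conjugate (?M *\<^sub>v v) = ?M *\<^sub>v conjugate v"
    using M v by (intro eq_vecI) (auto simp: scalar_prod_def)
  hence ec: "?M *\<^sub>v conjugate v = cnj z \<cdot>\<^sub>v conjugate v"
    by (simp add: ev conjugate_smult_vec)
  have "(?M *\<^sub>v conjugate v) \<bullet> v = conjugate v \<bullet> (?M *\<^sub>v v)"
    using transpose_vec_mult_scalar[OF M' v cv] symc by simp
  hence "cnj z * (conjugate v \<bullet> v) = z * (conjugate v \<bullet> v)"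
    using v cv by (simp add: ec ev)
  moreover have "conjugate v \<bullet> v \<noteq> 0"
    using conjugate_square_eq_0_vec[OF v] v0 conjugate_vec_sprod_comm[OF v v] by simp
  ultimately have "cnj z = z" by simp
  hence zr: "z = ?h (Re z)" by (metis Reals_cnj_iff of_real_Re)
  \<comment> \<open>The characteristic polynomial of \<open>?M\<close> is the image of the real one,
    and \<open>z\<close> is the image of \<open>Re z\<close>.\<close>
  have "poly (map_poly ?h (char_poly M)) (?h (Re z)) = 0"
    using z zr of_real_hom.char_poly_hom[OF M, where 'a = complex] by metis
  hence "poly (char_poly M) (Re z) = 0" by simp
  thus ?thesis using eigenvalue_root_char_poly[OF M] by blast
qed

text \<open>Gram-Schmidt, applied to a basis that starts with \<open>v\<close>, leaves its head
  unchanged; normalising then only rescales \<open>v\<close>.\<close>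

lemma orthogonal_completion:
  fixes v :: "real vec"
  assumes v: "v \<in> carrier_vec n" and v0: "v \<noteq> 0\<^sub>v n"
  shows "\<exists>W a. W \<in> carrier_mat n n \<and> transpose_mat W * W = 1\<^sub>m n \<and> col W 0 = a \<cdot>\<^sub>v v"
proof -
  have n: "n \<noteq> 0" using v v0 by auto
  interpret cof_vec_space n "TYPE(real)" .
  define b where "b = basis_completion v"
  define ws where "ws = gram_schmidt n b"
  from basis_completion[OF v v0, folded b_def]
  have dist_b: "distinct b" and indep: "\<not> lin_dep (set b)" and b: "set b \<subseteq> carrier_vec n"
    and hdb: "hd b = v" and len_b: "length b = n" by auto
  from hdb len_b n obtain vs where bv: "b = v # vs" by (cases b) auto
  from gram_schmidt_result[OF b dist_b indep refl, folded ws_def]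
  have ws: "set ws \<subseteq> carrier_vec n" "corthogonal ws" "length ws = n"
    by (auto simp: len_b)
  have "hd ws = v" unfolding ws_def bv using gram_schmidt_hd[OF v] .
  hence ws0: "ws ! 0 = v" using ws(3) n by (simp add: hd_conv_nth flip: length_0_conv)
  have wsc: "ws ! j \<in> carrier_vec n" if "j < n" for j using ws that by auto
  \<comment> \<open>The lengths of the orthogonal vectors; \<open>corthogonal\<close> also makes
    them nonzero, so dividing by them yields orthonormal columns.\<close>
  define l where "l = (\<lambda>j. sqrt (ws ! j \<bullet> ws ! j))"
  define W where "W = mat n n (\<lambda>(i,j). ws ! j $ i / l j)"
  have W: "W \<in> carrier_mat n n" unfolding W_def by simp
  have colW: "col W j = (1 / l j) \<cdot>\<^sub>v ws ! j" if "j < n" for j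
    using wsc[OF that] that unfolding W_def by (intro eq_vecI) auto
  have "transpose_mat W * W = 1\<^sub>m n"
  proof (rule eq_matI)
    fix i j assume "i < dim_row (1\<^sub>m n :: real mat)" "j < dim_col (1\<^sub>m n :: real mat)"
    hence ij: "i < n" "j < n" by auto
    have "(transpose_mat W * W) $$ (i,j) = col W i \<bullet> col W j" using W ij by simp
    also have "\<dots> = (ws ! i \<bullet> ws ! j) / (l i * l j)"
      using wsc[OF ij(1)] wsc[OF ij(2)] ij by (simp add: colW)
    also have "\<dots> = (if i = j then 1 else 0)"
    proof (cases "i = j")
      case False
      thus ?thesis using corthogonalD[OF ws(2), of i j] ij ws(3) by simp
    next
      case True
      have "ws ! j \<bullet> ws ! j \<noteq> 0" using corthogonalD[OF ws(2), of j j] ij ws(3) by simp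
      moreover have "ws ! j \<bullet> ws ! j \<ge> 0"
        using conjugate_square_ge_0_vec[of "ws ! j"] by simp
      ultimately show ?thesis using True by (simp add: l_def)
    qed
    finally show "(transpose_mat W * W) $$ (i,j) = 1\<^sub>m n $$ (i,j)" using ij by simp
  qed (use W in auto)
  thus ?thesis using W colW[of 0] n ws0 by auto
qed

text \<open>Induction by deflation: in an orthonormal basis whose first vector is an eigenvector,
  symmetry makes the matrix block diagonal, with the eigenvalue in one block and a smaller symmetric
  matrix in the other.\<close>

theorem real_symmetric_diagonalization:
  fixes M :: "real mat"
  assumes "M \<in> carrier_mat n n" and "transpose_mat M = M"
  shows "\<exists>P d. P \<in> carrier_mat n n \<and> transpose_mat P * P = 1\<^sub>m n \<and>
    transpose_mat P * M * P = mat_diag n d"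
  using assms
proof (induction n arbitrary: M)
  case 0
  thus ?case
    by (intro exI[of _ "1\<^sub>m 0"] exI[of _ "\<lambda>_. 0"]) (auto intro!: eq_matI simp: mat_diag_def)
next
  case (Suc k)
  let ?n = "Suc k"
  note M = Suc.prems(1)
  obtain e where "eigenvalue M e"
    using real_symmetric_eigenvalue_exists[OF Suc.prems] by blast
  then obtain v where v: "v \<in> carrier_vec ?n" and v0: "v \<noteq> 0\<^sub>v ?n" and ev: "M *\<^sub>v v = e \<cdot>\<^sub>v v"
    using M unfolding eigenvalue_def eigenvector_def by auto
  obtain W a where W: "W \<in> carrier_mat ?n ?n" and WW: "transpose_mat W * W = 1\<^sub>m ?n"
    and W0: "col W 0 = a \<cdot>\<^sub>v v"
    using orthogonal_completion[OF v v0] by blast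
  let ?Wt = "transpose_mat W"
  have Wt: "?Wt \<in> carrier_mat ?n ?n" using W by simp
  define B where "B = ?Wt * M * W"
  have B: "B \<in> carrier_mat ?n ?n" using W M unfolding B_def by simp
  have symB: "transpose_mat B = B"
    unfolding B_def using W Wt M Suc.prems(2)
    by (simp add: transpose_mult[of _ ?n ?n _ ?n] assoc_mult_mat[of _ ?n ?n _ ?n _ ?n])
  \<comment> \<open>The first column of \<open>W\<close> is a multiple of an eigenvector, and
    \<open>?Wt\<close> sends it to the first unit vector; hence column 0 of \<open>B\<close> is
    \<open>e\<close> times that unit vector.\<close>
  have "M *\<^sub>v col W 0 = e \<cdot>\<^sub>v col W 0"
    unfolding W0 using M v by (simp add: mult_mat_vec ev smult_smult_assoc mult.commute)
  moreover have "col B 0 = ?Wt *\<^sub>v (M *\<^sub>v col W 0)"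
    unfolding B_def assoc_mult_mat[OF Wt M W]
    using col_mult2[OF Wt mult_carrier_mat[OF M W], of 0] col_mult2[OF M W, of 0] by simp
  moreover have "?Wt *\<^sub>v col W 0 = col (1\<^sub>m ?n) 0"
    using col_mult2[OF Wt W, of 0] WW by simp
  moreover have "col W 0 \<in> carrier_vec ?n" using W by (metis carrier_matD(1) col_dim)
  ultimately have colB: "col B 0 = e \<cdot>\<^sub>v col (1\<^sub>m ?n) 0"
    using mult_mat_vec[OF Wt] by simp
  have B0: "B $$ (i,0) = (if i = 0 then e else 0)" if "i < ?n" for i
    using arg_cong[OF colB, of "\<lambda>u. u $ i"] B that by simp
  \<comment> \<open>Symmetry carries the shape of the first column over to the first row.\<close>
  have B0': "B $$ (0,j) = (if j = 0 then e else 0)" if "j < ?n" for j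
    using B0[OF that] symB B that by (metis carrier_matD index_transpose_mat(1) zero_less_Suc)
  define L where "L = mat k k (\<lambda>(i,j). B $$ (Suc i, Suc j))"
  have L: "L \<in> carrier_mat k k" unfolding L_def by simp
  have symL: "transpose_mat L = L"
  proof (rule eq_matI)
    fix i j assume "i < dim_row L" "j < dim_col L"
    hence "i < k" "j < k" using L by auto
    thus "transpose_mat L $$ (i,j) = L $$ (i,j)"
      using symB B unfolding L_def
      by (simp, metis Suc_less_eq carrier_matD index_transpose_mat(1))
  qed (use L in auto)
  define F where "F = mat 1 1 (\<lambda>_. e)"
  have F: "F \<in> carrier_mat 1 1" unfolding F_def by simp
  have Bblock: "B = four_block_mat F (0\<^sub>m 1 k) (0\<^sub>m k 1) L"
    using B by (intro eq_matI) (auto simp: L_def F_def B0 B0')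
  obtain P d where P: "P \<in> carrier_mat k k" and PP: "transpose_mat P * P = 1\<^sub>m k"
    and PLP: "transpose_mat P * L * P = mat_diag k d"
    using Suc.IH[OF L symL] by blast
  \<comment> \<open>\<open>Q\<close> fixes the first coordinate and diagonalizes the lower block;
    \<open>W * Q\<close> will diagonalize \<open>M\<close>.\<close>
  define Q where "Q = four_block_mat (1\<^sub>m 1) (0\<^sub>m 1 k) (0\<^sub>m k 1) P"
  have Q: "Q \<in> carrier_mat ?n ?n" using P unfolding Q_def by auto
  have Qt: "transpose_mat Q = four_block_mat (1\<^sub>m 1) (0\<^sub>m 1 k) (0\<^sub>m k 1) (transpose_mat P)"
    unfolding Q_def using P by (subst transpose_four_block_mat) auto
  have QQ: "transpose_mat Q * Q = 1\<^sub>m ?n"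
    unfolding Qt unfolding Q_def using P
    by (subst mult_four_block_mat[of _ 1 1 _ k _ k _ _ 1 _ k]) (auto simp: PP)
  have QBQ: "transpose_mat Q * B * Q =
      four_block_mat F (0\<^sub>m 1 k) (0\<^sub>m k 1) (mat_diag k d)"
    unfolding Qt Bblock unfolding Q_def using P L F
    by (subst mult_four_block_mat[of _ 1 1 _ k _ k _ _ 1 _ k], auto)
       (subst mult_four_block_mat[of _ 1 1 _ k _ k _ _ 1 _ k], auto simp: PLP)
  \<comment> \<open>\<open>case_nat e d\<close> puts \<open>e\<close> at index 0 and shifts
    \<open>d\<close> by one place.\<close>
  also have "\<dots> = mat_diag ?n (case_nat e d)"
    by (intro eq_matI) (auto simp: F_def mat_diag_def split: nat.splits)
  finally have diag: "transpose_mat Q * B * Q = mat_diag ?n (case_nat e d)" .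
  have Qtc: "transpose_mat Q \<in> carrier_mat ?n ?n" using Q by simp
  have WQ: "transpose_mat (W * Q) = transpose_mat Q * ?Wt"
    using transpose_mult[OF W Q] .
  have "transpose_mat (W * Q) * (W * Q) = transpose_mat Q * (?Wt * W) * Q"
    unfolding WQ using W Wt Q Qtc by (simp add: assoc_mult_mat[of _ ?n ?n _ ?n _ ?n])
  hence 1: "transpose_mat (W * Q) * (W * Q) = 1\<^sub>m ?n"
    using WW QQ Qtc by simp
  have "transpose_mat (W * Q) * M * (W * Q) = transpose_mat Q * B * Q"
    unfolding WQ B_def using W Wt Q Qtc M by (simp add: assoc_mult_mat[of _ ?n ?n _ ?n _ ?n])
  thus ?case using 1 diag W Q by (intro exI[of _ "W * Q"] exI[of _ "case_nat e d"]) auto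
qed

section \<open>Adjoints\<close>

lemma mat_adjoint_conv_mat:
  "mat_adjoint A = mat (dim_col A) (dim_row A) (\<lambda>(i,j). conjugate (A $$ (j,i)))"
  unfolding mat_adjoint_def by (intro eq_matI) (auto simp: mat_of_rows_index)

lemma mat_adjoint_carrier[simp]: "A \<in> carrier_mat n m \<Longrightarrow> mat_adjoint A \<in> carrier_mat m n"
  unfolding mat_adjoint_conv_mat by auto

lemma mat_adjoint_mult:
  fixes A B :: "complex mat"
  assumes "A \<in> carrier_mat n m" and "B \<in> carrier_mat m l"
  shows "mat_adjoint (A * B) = mat_adjoint B * mat_adjoint A"
  using assms unfolding mat_adjoint_conv_mat
  by (intro eq_matI) (auto simp: scalar_prod_def mult.commute)

text \<open>A real scalar matrix is self-adjoint and commutes with every matrix, so both products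
  expand into the same four summands.\<close>

lemma normal_mat_add_real_scalar:
  fixes X :: "complex mat" and e :: real
  assumes X: "X \<in> carrier_mat n n" and norm: "normal_mat X"
  shows "normal_mat (X + of_real e \<cdot>\<^sub>m 1\<^sub>m n)"
proof -
  define E where "E = complex_of_real e \<cdot>\<^sub>m 1\<^sub>m n"
  let ?Y = "mat_adjoint X"
  have Y: "?Y \<in> carrier_mat n n" using X by simp
  have E: "E \<in> carrier_mat n n" unfolding E_def by simp
  have adj: "mat_adjoint (X + E) = ?Y + E"
    using X unfolding E_def mat_adjoint_conv_mat by (intro eq_matI) auto
  have comm: "E * Z = Z * E" if "Z \<in> carrier_mat n n" for Z
    using that mult_smult_distrib[OF that one_carrier_mat] mult_smult_assoc_mat[OF one_carrier_mat that]
    unfolding E_def by simp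
  have "(X + E) * (?Y + E) = (X * ?Y + X * E) + (?Y * E + E * E)"
    by (simp add: add_mult_distrib_mat[OF X E add_carrier_mat[OF E]]
        mult_add_distrib_mat[OF X Y E] mult_add_distrib_mat[OF E Y E] comm[OF Y])
  \<comment> \<open>The two middle summands change places, and normality of \<open>X\<close>
    rewrites the first one.\<close>
  also have "\<dots> = (?Y * X + ?Y * E) + (X * E + E * E)"
  proof -
    have "(a + b) + (c + d) = (a + c) + (b + d)"
      if "a \<in> carrier_mat n n" "b \<in> carrier_mat n n" "c \<in> carrier_mat n n" "d \<in> carrier_mat n n"
      for a b c d :: "complex mat"
      using that by (intro eq_matI) auto
    moreover have "X * ?Y = ?Y * X" using norm unfolding normal_mat_def by simp
    ultimately show ?thesis using X Y E by (metis mult_carrier_mat)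
  qed
  also have "\<dots> = (?Y + E) * (X + E)"
    by (simp add: add_mult_distrib_mat[OF Y E add_carrier_mat[OF E]]
        mult_add_distrib_mat[OF Y X E] mult_add_distrib_mat[OF E X E] comm[OF X])
  finally show ?thesis using X E unfolding normal_mat_def E_def[symmetric] adj by simp
qed

text \<open>The adjoint divided by \<open>r\<close> is a right inverse of the square matrix
  \<open>X\<close>, hence also a left inverse.\<close>

lemma normal_mat_if_scaled_unitary:
  fixes X :: "complex mat"
  assumes X: "X \<in> carrier_mat n n" and r: "r \<noteq> 0" and eq: "X * mat_adjoint X = r \<cdot>\<^sub>m 1\<^sub>m n"
  shows "normal_mat X"
proof -
  let ?Y = "mat_adjoint X"
  have Y: "?Y \<in> carrier_mat n n" using X by simp
  have smult_smult: "a \<cdot>\<^sub>m (b \<cdot>\<^sub>m Z) = (a * b) \<cdot>\<^sub>m Z" for a b :: complex and Z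
    by (intro eq_matI) auto
  have one_smult: "1 \<cdot>\<^sub>m Z = Z" for Z :: "complex mat"
    by (intro eq_matI) auto
  have "X * ((1/r) \<cdot>\<^sub>m ?Y) = 1\<^sub>m n"
    using r by (simp add: mult_smult_distrib[OF X Y] eq smult_smult one_smult)
  hence "(1/r) \<cdot>\<^sub>m ?Y * X = 1\<^sub>m n"
    using mat_mult_left_right_inverse[OF X _] Y by simp
  hence "(1/r) \<cdot>\<^sub>m (?Y * X) = 1\<^sub>m n" using mult_smult_assoc_mat[OF Y X] by simp
  hence "r \<cdot>\<^sub>m ((1/r) \<cdot>\<^sub>m (?Y * X)) = r \<cdot>\<^sub>m 1\<^sub>m n" by simp
  hence "?Y * X = r \<cdot>\<^sub>m 1\<^sub>m n" using r by (simp add: smult_smult one_smult)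
  thus ?thesis using X eq unfolding normal_mat_def by simp
qed

section \<open>Normal matrices with prescribed real part\<close>

lemma invertible_real_part_of_normal:
  fixes C :: "real mat"
  assumes C: "C \<in> carrier_mat n n" and det: "det C \<noteq> 0"
  shows "\<exists>X. X \<in> carrier_mat n n \<and> normal_mat X \<and> map_mat Re X = C"
proof -
  have Ct: "transpose_mat C \<in> carrier_mat n n" using C by simp
  have "transpose_mat (C * transpose_mat C) = C * transpose_mat C"
    using transpose_mult[OF C Ct] by simp
  then obtain P d where P: "P \<in> carrier_mat n n" and PP: "transpose_mat P * P = 1\<^sub>m n"
    and diag: "transpose_mat P * (C * transpose_mat C) * P = mat_diag n d"
    using real_symmetric_diagonalization[of "C * transpose_mat C" n] C by auto
  have Pt: "transpose_mat P \<in> carrier_mat n n" using P by simp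
  have PP': "P * transpose_mat P = 1\<^sub>m n" using mat_mult_left_right_inverse[OF Pt P PP] .
  define N where "N = transpose_mat P * C"
  have N: "N \<in> carrier_mat n n" using P C unfolding N_def by simp
  have Nt: "transpose_mat N \<in> carrier_mat n n" using N by simp
  have PN: "P * N = C"
    unfolding N_def using assoc_mult_mat[OF P Pt C] PP' C by simp
  have NN: "N * transpose_mat N = mat_diag n d"
    unfolding diag[symmetric] N_def using P Pt C Ct
    by (simp add: transpose_mult[of _ n n _ n] assoc_mult_mat[of _ n n _ n _ n])
  have rows: "row N i \<bullet> row N j = (if i = j then d j else 0)" if "i < n" "j < n" for i j
    using arg_cong[OF NN, of "\<lambda>A. A $$ (i,j)"] N that by (simp add: mat_diag_def)
  have detN: "det N \<noteq> 0"
    using det_mult[OF P N] det PN by auto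
  \<comment> \<open>\<open>d i\<close> is the squared length of row \<open>i\<close> of
    \<open>N\<close>. It cannot vanish, because the product of all \<open>d j\<close> is the
    determinant of \<open>N * transpose_mat N\<close>, the square of \<open>det N\<close>.\<close>
  have d: "d i > 0" if i: "i < n" for i
  proof -
    have "row N i \<bullet> row N i \<ge> 0" using conjugate_square_ge_0_vec[of "row N i"] by simp
    moreover have "d i \<noteq> 0"
    proof
      assume "d i = 0"
      moreover have "det (mat_diag n d) = (\<Prod>j = 0..<n. d j)"
        by (subst det_upper_triangular[of _ n]) (auto simp: mat_diag_def prod_list_diag_prod)
      ultimately have "det (mat_diag n d) = 0" using i by auto
      thus False using det_mult[OF N Nt] detN det_transpose[OF N] NN by simp
    qed
    ultimately show ?thesis using rows[OF i i] by simp
  qed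
  \<comment> \<open>Any positive upper bound of the \<open>d i\<close> would do; the summand 1 keeps
    \<open>r\<close> positive even for \<open>n = 0\<close>.\<close>
  define r where "r = 1 + (\<Sum>i<n. d i)"
  have dr: "d i \<le> r" if "i < n" for i
  proof -
    have "d i \<le> (\<Sum>i<n. d i)"
      using that d by (intro member_le_sum) (auto simp: less_imp_le)
    thus ?thesis unfolding r_def by simp
  qed
  have r: "r > 0" unfolding r_def using d by (intro add_pos_nonneg sum_nonneg) (auto simp: less_imp_le)
  define g where "g = (\<lambda>i. sqrt (r / d i - 1))"
  have g: "(1 + (g i)\<^sup>2) * d i = r" if "i < n" for i
    using d[OF that] dr[OF that] unfolding g_def by (simp add: field_simps)
  define Y where "Y = mat n n (\<lambda>(i,j). Complex 1 (g i) * of_real (N $$ (i,j)))"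
  let ?P = "map_mat complex_of_real P"
  have Y: "Y \<in> carrier_mat n n" unfolding Y_def by simp
  have Pc: "?P \<in> carrier_mat n n" using P by simp
  have YY: "Y * mat_adjoint Y = of_real r \<cdot>\<^sub>m 1\<^sub>m n"
  proof (rule eq_matI)
    fix i j
    assume "i < dim_row (of_real r \<cdot>\<^sub>m 1\<^sub>m n :: complex mat)"
      "j < dim_col (of_real r \<cdot>\<^sub>m 1\<^sub>m n :: complex mat)"
    hence ij: "i < n" "j < n" by auto
    have "(Y * mat_adjoint Y) $$ (i,j) =
        (\<Sum>k = 0..<n. Complex 1 (g i) * cnj (Complex 1 (g j)) * of_real (N $$ (i,k) * N $$ (j,k)))"
      using ij unfolding Y_def mat_adjoint_conv_mat by (simp add: scalar_prod_def ac_simps)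
    also have "\<dots> = Complex 1 (g i) * cnj (Complex 1 (g j)) * of_real (row N i \<bullet> row N j)"
      using ij N by (simp add: scalar_prod_def sum_distrib_left)
    \<comment> \<open>Off the diagonal the rows of \<open>N\<close> are orthogonal; on it the factor
      is the squared modulus \<open>1 + (g i)\<^sup>2\<close>, and \<open>g\<close> was chosen to
      make the product \<open>r\<close>.\<close>
    also have "\<dots> = (if i = j then of_real r else 0)"
      using rows[OF ij] g[OF ij(1)]
      by (auto simp: complex_eq_iff power2_eq_square algebra_simps)
    finally show "(Y * mat_adjoint Y) $$ (i,j) = (of_real r \<cdot>\<^sub>m 1\<^sub>m n) $$ (i,j)" using ij by simp
  qed (use Y in \<open>auto simp: mat_adjoint_conv_mat\<close>)
  have adjP: "mat_adjoint ?P = map_mat complex_of_real (transpose_mat P)"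
    unfolding mat_adjoint_conv_mat by (intro eq_matI) auto
  have PPc: "?P * mat_adjoint ?P = 1\<^sub>m n"
    unfolding adjP of_real_hom.mat_hom_mult[OF P Pt, symmetric] PP' by (rule of_real_hom.mat_hom_one)
  define X where "X = ?P * Y"
  have X: "X \<in> carrier_mat n n" using Pc Y unfolding X_def by simp
  have cs: "mat_adjoint ?P \<in> carrier_mat n n" "mat_adjoint Y \<in> carrier_mat n n"
    using Pc Y by auto
  have "X * mat_adjoint X = ?P * (Y * mat_adjoint Y) * mat_adjoint ?P"
    unfolding X_def mat_adjoint_mult[OF Pc Y] using Pc Y cs
    by (simp add: assoc_mult_mat[of _ n n _ n _ n] mult_carrier_mat[of _ n n _ n])
  also have "\<dots> = of_real r \<cdot>\<^sub>m 1\<^sub>m n"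
    unfolding YY mult_smult_distrib[OF Pc one_carrier_mat] right_mult_one_mat[OF Pc]
      mult_smult_assoc_mat[OF Pc cs(1)] PPc ..
  finally have "normal_mat X"
    using normal_mat_if_scaled_unitary[OF X, of "of_real r"] r by simp
  \<comment> \<open>\<open>?P\<close> is real, so taking real parts passes to \<open>Y\<close>,
    whose real part is \<open>N\<close>.\<close>
  moreover have "map_mat Re X = P * N"
    using P N unfolding X_def Y_def by (intro eq_matI) (auto simp: scalar_prod_def)
  ultimately show ?thesis using X PN by auto
qed

theorem theorem2:
  fixes n :: nat and A :: "real mat"
  assumes "n \<ge> 1" and "A \<in> carrier_mat n n"
  shows "\<exists>X :: complex mat. X \<in> carrier_mat n n \<and> normal_mat X \<and> map_mat Re X = A"
proof -
  note A = assms(2)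
  \<comment> \<open>A monic polynomial has finitely many roots, so some real \<open>e\<close> is not
    an eigenvalue, and \<open>char_matrix A e\<close>, which is \<open>A\<close> minus
    \<open>e\<close> times the identity, is invertible.\<close>
  have "char_poly A \<noteq> 0" using degree_monic_char_poly[OF A] by auto
  hence "finite {e. poly (char_poly A) e = 0}" by (rule poly_roots_finite)
  then obtain e where "poly (char_poly A) e \<noteq> 0"
    using infinite_UNIV_char_0[where 'a = real] by (metis (mono_tags) UNIV_eq_I mem_Collect_eq)
  hence "det (char_matrix A e) \<noteq> 0"
    using eigenvalue_root_char_poly[OF A] eigenvalue_det[OF A] by simp
  then obtain X where X: "X \<in> carrier_mat n n" "normal_mat X" "map_mat Re X = char_matrix A e"
    using invertible_real_part_of_normal[of "char_matrix A e" n] A by auto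
  let ?Y = "X + of_real e \<cdot>\<^sub>m 1\<^sub>m n"
  have "map_mat Re ?Y = map_mat Re X + e \<cdot>\<^sub>m 1\<^sub>m n"
    using X(1) by (intro eq_matI) auto
  also have "\<dots> = A" unfolding X(3) char_matrix_def using A by (intro eq_matI) auto
  finally show ?thesis
    using X normal_mat_add_real_scalar[OF X(1,2), of e] by (intro exI[of _ ?Y]) auto
qed

end
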